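(* Let $n\ge 6$ be an integer congruent to $0$, $2$ or $6$ modulo $8$. Then the Weierstrass group $W_n$ is not pseudomodular.
   Context: $PSL(2,\mathbb{R})$ acts on the upper half-plane $\mathbb{H}^2$ and on $\partial_\infty\mathbb{H}^2=\mathbb{R}\cup\{\infty\}$ by fractional linear transformations. Elements of $PGL(2,\mathbb{Q})$ of positive determinant are regarded as elements of $PSL(2,\mathbb{R})$ by rescaling. The cusps of a Fuchsian group are the points of $\mathbb{R}\cup\{\infty\}$ fixed by its parabolic elements. Two Fuchsian groups are commensurable if they share a common subgroup that has finite index in both. A pseudomodular group is a discrete subgroup $\Gamma\le PGL(2,\mathbb{Q})$ which is not commensurable with $PSL(2,\mathbb{Z})$ and whose cusp set is precisely $\mathbb{Q}\cup\{\infty\}$. For a positive integer $n$, the $n$-th Weierstrass group is the discrete group $W_n=\langle\rho_1,\rho_{1/n},\rho_n\rangle\le PSL(2,\mathbb{R})$, where $$\rho_1=\begin{pmatrix}1&2\\-1&-1\end{pmatrix},\quad \rho_{1/n}=\sqrt n\begin{pmatrix}1&1\\ \frac{-n-1}{n}&-1\end{pmatrix},\quad \rho_n=\frac1{\sqrt n}\begin{pmatrix}0&n\\-1&0\end{pmatrix}.$$ *)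

theory Defs
  imports "HOL-Analysis.Analysis" "HOL-Algebra.Coset" "HOL-Algebra.Generated_Groups"
begin

section \<open>The group $PSL(2,R)$\<close>

definition mat2 :: "'a \<Rightarrow> 'a \<Rightarrow> 'a \<Rightarrow> 'a \<Rightarrow> 'a::zero ^ 2 ^ 2" where
  "mat2 a b c d = vector [vector [a, b], vector [c, d]]"

definition SL2R :: "(real ^ 2 ^ 2) monoid" where
  "SL2R = \<lparr>carrier = {A. det A = 1}, mult = (**), one = mat 1\<rparr>"

definition center_SL2R :: "(real ^ 2 ^ 2) set" where
  "center_SL2R = {mat 1, - mat 1}"

definition PSL2R :: "(real ^ 2 ^ 2) set monoid" where
  "PSL2R = SL2R Mod center_SL2R"

definition psl :: "real ^ 2 ^ 2 \<Rightarrow> (real ^ 2 ^ 2) set" where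
  "psl A = center_SL2R #>\<^bsub>SL2R\<^esub> A"

lemma mat2_nth [simp]:
  "mat2 a b c d $ 1 $ 1 = a" "mat2 a b c d $ 1 $ 2 = b"
  "mat2 a b c d $ 2 $ 1 = c" "mat2 a b c d $ 2 $ 2 = d"
  by (simp_all add: mat2_def)

lemma det_mat2: "det (mat2 a b c d :: real ^ 2 ^ 2) = a * d - b * c"
  by (simp add: det_2)

lemma SL2R_simps [simp]:
  "carrier SL2R = {A. det A = 1}" "A \<otimes>\<^bsub>SL2R\<^esub> B = A ** B" "\<one>\<^bsub>SL2R\<^esub> = mat 1"
  by (simp_all add: SL2R_def)

lemma uminus_matrix_mul: "(- A) ** B = - (A ** B)" "A ** (- B) = - (A ** B)"
  for A B :: "real ^ 2 ^ 2"
  by (simp_all add: matrix_matrix_mult_def vec_eq_iff sum_negf)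

lemma det_uminus_2: "det (- A) = det A" for A :: "real ^ 2 ^ 2"
  by (simp add: det_2)

lemma group_SL2R: "group SL2R"
proof (rule groupI)
  fix A assume "A \<in> carrier SL2R"
  then have d: "det A = 1"
    by simp
  then have "invertible A"
    by (simp add: invertible_det_nz)
  then obtain B where B: "B ** A = mat 1"
    by (auto simp: invertible_def)
  then have "det B * det A = 1"
    by (metis det_I det_mul)
  with d B show "\<exists>B\<in>carrier SL2R. B \<otimes>\<^bsub>SL2R\<^esub> A = \<one>\<^bsub>SL2R\<^esub>"
    by auto
qed (auto simp: det_mul matrix_mul_assoc)

lemma normal_center_SL2R: "center_SL2R \<lhd> SL2R"
proof -
  interpret group SL2R
    by (rule group_SL2R)
  have "- mat 1 \<in> Units SL2R" and i: "inv\<^bsub>SL2R\<^esub> (- mat 1) = - mat 1"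
    by (auto intro!: inv_equality simp: uminus_matrix_mul det_uminus_2)
  then have "subgroup center_SL2R SL2R"
    using inv_one by (unfold_locales)
      (auto simp: center_SL2R_def uminus_matrix_mul det_uminus_2)
  then show ?thesis
    by (rule normalI)
      (auto simp: center_SL2R_def r_coset_def l_coset_def uminus_matrix_mul)
qed

lemma group_PSL2R: "group PSL2R"
  unfolding PSL2R_def by (rule normal.factorgroup_is_group[OF normal_center_SL2R])

lemma psl_eq: "psl A = {A, - A}"
  by (auto simp: psl_def r_coset_def center_SL2R_def uminus_matrix_mul)

lemma carrier_PSL2R: "carrier PSL2R = psl ` {A. det A = 1}"
  by (simp add: PSL2R_def carrier_FactGroup psl_def [abs_def])


section \<open>The action on the boundary of the hyperbolic plane\<close>

text \<open>
  The boundary $R \cup \{\infty\}$ is the type \<open>real option\<close>, where \<open>None\<close> is the point at infinity.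
\<close>

definition moebius :: "real ^ 2 ^ 2 \<Rightarrow> real option \<Rightarrow> real option" where
  "moebius A p = (case p of
      None \<Rightarrow> if A$2$1 = 0 then None else Some (A$1$1 / A$2$1)
    | Some x \<Rightarrow> if A$2$1 * x + A$2$2 = 0 then None
                else Some ((A$1$1 * x + A$1$2) / (A$2$1 * x + A$2$2)))"

definition psl_act :: "(real ^ 2 ^ 2) set \<Rightarrow> real option \<Rightarrow> real option" where
  "psl_act g p = moebius (SOME A. A \<in> g) p"

lemma moebius_uminus: "moebius (- A) p = moebius A p"
proof (cases p)
  case (Some x)
  have "(- u - v) / (- w - z) = (u + v) / (w + z)" for u v w z :: real
    using minus_divide_divide[of "u + v" "w + z"] by simp
  then show ?thesis
    unfolding moebius_def using Some by (auto simp: algebra_simps)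
qed (simp add: moebius_def)

lemma psl_act_psl: "psl_act (psl A) p = moebius A p"
proof -
  have "(SOME B. B \<in> psl A) \<in> psl A"
    by (rule someI[of _ A]) (simp add: psl_eq)
  then show ?thesis
    by (auto simp: psl_act_def psl_eq moebius_uminus)
qed


section \<open>Fuchsian groups, cusps and commensurability\<close>

definition PSL2R_topology :: "(real ^ 2 ^ 2) set topology" where
  "PSL2R_topology = topology (\<lambda>U. U \<subseteq> carrier PSL2R \<and>
     openin (top_of_set (carrier SL2R)) {A \<in> carrier SL2R. psl A \<in> U})"

lemma openin_PSL2R_topology:
  "openin PSL2R_topology U \<longleftrightarrow> U \<subseteq> carrier PSL2R \<and>
     openin (top_of_set (carrier SL2R)) {A \<in> carrier SL2R. psl A \<in> U}"
proof -
  let ?X = "top_of_set (carrier SL2R)"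
  let ?pre = "\<lambda>U. {A \<in> carrier SL2R. psl A \<in> U}"
  have "istopology (\<lambda>U. U \<subseteq> carrier PSL2R \<and> openin ?X (?pre U))"
    unfolding istopology_def
  proof (intro conjI allI impI)
    fix S T
    assume "S \<subseteq> carrier PSL2R \<and> openin ?X (?pre S)" "T \<subseteq> carrier PSL2R \<and> openin ?X (?pre T)"
    moreover have "?pre (S \<inter> T) = ?pre S \<inter> ?pre T"
      by auto
    ultimately show "S \<inter> T \<subseteq> carrier PSL2R" "openin ?X (?pre (S \<inter> T))"
      by (auto simp del: SL2R_simps)
  next
    fix K
    assume *: "\<forall>S\<in>K. S \<subseteq> carrier PSL2R \<and> openin ?X (?pre S)"
    then show "\<Union>K \<subseteq> carrier PSL2R"
      by auto
    have "?pre (\<Union>K) = (\<Union>S\<in>K. ?pre S)"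
      by auto
    moreover have "openin ?X (\<Union>S\<in>K. ?pre S)"
      using * by (intro openin_Union) auto
    ultimately show "openin ?X (?pre (\<Union>K))"
      by (simp del: SL2R_simps)
  qed
  then show ?thesis
    unfolding PSL2R_topology_def by (simp add: topology_inverse')
qed

lemma topspace_PSL2R_topology: "topspace PSL2R_topology = carrier PSL2R"
proof (rule antisym)
  show "topspace PSL2R_topology \<subseteq> carrier PSL2R"
    using openin_PSL2R_topology openin_topspace by blast
  have "{A \<in> carrier SL2R. psl A \<in> carrier PSL2R} = carrier SL2R"
    by (auto simp: carrier_PSL2R)
  then have "openin PSL2R_topology (carrier PSL2R)"
    by (simp add: openin_PSL2R_topology del: SL2R_simps)
  then show "carrier PSL2R \<subseteq> topspace PSL2R_topology"
    by (rule openin_subset)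
qed

definition fuchsian :: "(real ^ 2 ^ 2) set set \<Rightarrow> bool" where
  "fuchsian \<Gamma> \<longleftrightarrow> subgroup \<Gamma> PSL2R \<and> subtopology PSL2R_topology \<Gamma> = discrete_topology \<Gamma>"

definition parabolic :: "(real ^ 2 ^ 2) set \<Rightarrow> bool" where
  "parabolic g \<longleftrightarrow> g \<in> carrier PSL2R \<and> g \<noteq> \<one>\<^bsub>PSL2R\<^esub> \<and> (\<forall>A\<in>g. \<bar>trace A\<bar> = 2)"

definition cusps :: "(real ^ 2 ^ 2) set set \<Rightarrow> real option set" where
  "cusps \<Gamma> = {p. \<exists>g\<in>\<Gamma>. parabolic g \<and> psl_act g p = p}"

definition finite_index :: "('a, 'b) monoid_scheme \<Rightarrow> 'a set \<Rightarrow> 'a set \<Rightarrow> bool" where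
  "finite_index G K H \<longleftrightarrow> subgroup K (G\<lparr>carrier := H\<rparr>) \<and> finite (rcosets\<^bsub>G\<lparr>carrier := H\<rparr>\<^esub> K)"

definition commensurable :: "('a, 'b) monoid_scheme \<Rightarrow> 'a set \<Rightarrow> 'a set \<Rightarrow> bool" where
  "commensurable G H\<^sub>1 H\<^sub>2 \<longleftrightarrow> (\<exists>K. finite_index G K H\<^sub>1 \<and> finite_index G K H\<^sub>2)"


section \<open>Pseudomodular groups\<close>

text \<open>
  The matrices over the rationals of positive determinant, modulo scalars, are embedded in
  $PSL(2,R)$ by rescaling to determinant 1.
\<close>

definition PGL2Q_pos :: "(real ^ 2 ^ 2) set set" where
  "PGL2Q_pos = {psl ((1 / sqrt (of_rat (det B))) *\<^sub>R (\<chi> i j. of_rat (B$i$j))) |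
                  B :: rat ^ 2 ^ 2. det B > 0}"

definition PSL2Z :: "(real ^ 2 ^ 2) set set" where
  "PSL2Z = {psl (\<chi> i j. of_int (B$i$j)) | B :: int ^ 2 ^ 2. det B = 1}"

definition pseudomodular :: "(real ^ 2 ^ 2) set set \<Rightarrow> bool" where
  "pseudomodular \<Gamma> \<longleftrightarrow>
     fuchsian \<Gamma> \<and> \<Gamma> \<subseteq> PGL2Q_pos \<and> \<not> commensurable PSL2R \<Gamma> PSL2Z \<and>
     cusps \<Gamma> = insert None (Some ` \<rat>)"


section \<open>Weierstrass groups\<close>

definition rho_one :: "real ^ 2 ^ 2" where
  "rho_one = mat2 1 2 (-1) (-1)"

definition rho_inv_n :: "nat \<Rightarrow> real ^ 2 ^ 2" where
  "rho_inv_n n = sqrt n *\<^sub>R mat2 1 1 ((- real n - 1) / n) (-1)"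

definition rho_n :: "nat \<Rightarrow> real ^ 2 ^ 2" where
  "rho_n n = (1 / sqrt n) *\<^sub>R mat2 0 n (-1) 0"

definition weierstrass_group :: "nat \<Rightarrow> (real ^ 2 ^ 2) set set" where
  "weierstrass_group n = generate PSL2R {psl rho_one, psl (rho_inv_n n), psl (rho_n n)}"

lemma det_rho:
  assumes "n > 0"
  shows "det rho_one = 1" "det (rho_inv_n n) = 1" "det (rho_n n) = 1"
  using assms by (simp_all add: rho_one_def rho_inv_n_def rho_n_def det_2 field_simps)

end

theory Submission
  imports Defs
begin

text \<open>
  In a discrete group a point fixed by a hyperbolic element is never a cusp: conjugating a
  parabolic element with the same fixed point by powers of the hyperbolic one contracts it to the
  identity (\<open>hyperbolic_fixed_point_not_cusp\<close>). A pseudomodular group has every rational number as a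
  cusp, so it suffices to find in \<open>W\<^sub>n\<close> one hyperbolic element with a rational fixed point.

  Write $a$, $b$, $c$ for the three involutions $\rho_1$, $\rho_{1/n}$, $\rho_n$ and $T = cba$ for
  the translation by $n + 2$. Read as products of matrices, the hyperbolic elements are
  \<^item> $(caba) T^k (caba)$ fixing $-n/2$, for $n = 8k + 8$;
  \<^item> $c T^{-k} (ababa) T^k c a$ fixing $-2n/(n+2)$, for $n = 4k + 6$.

  They come from following the geodesic towards the rational point through the images of the ideal
  triangle with vertices $\infty$, $-1$, $0$ and recording the involutions until the point recurs.
  The residue of $n$ is what makes the exponent $k$ an integer. In both cases a matrix of
  determinant $n^4$ multiplies an integer vector over the fixed point by a number, $2n$ or $4$, of
  smaller square. Hence the normalized eigenvalue has modulus less than 1, and the element is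
  hyperbolic. The computations use integer matrices: all scalars, including the square roots in the
  generators, disappear in the projective group (\<open>pgl\<close>).
\<close>


section \<open>Matrix representatives of elements of $PSL(2,R)$\<close>

lemma mat2_mult:
  "mat2 a b c d ** mat2 e f g h = mat2 (a*e + b*g) (a*f + b*h) (c*e + d*g) (c*f + d*h)"
  for a b c d :: real
  by (simp add: matrix_matrix_mult_def vec_eq_iff forall_2 sum_2)

lemma mat2_mult_vec: "mat2 a b c d *v vector [x, y] = vector [a*x + b*y, c*x + d*y]"
  for a b c d :: real
  by (simp add: matrix_vector_mult_def vec_eq_iff forall_2 sum_2)

lemma mat2_eta: "mat2 (A$1$1) (A$1$2) (A$2$1) (A$2$2) = A" for A :: "real ^ 2 ^ 2"
  by (simp add: vec_eq_iff forall_2)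

lemma one_PSL2R: "\<one>\<^bsub>PSL2R\<^esub> = psl (mat 1)"
  by (auto simp: PSL2R_def FactGroup_def psl_eq center_SL2R_def)

lemma psl_mult:
  assumes "det A = 1" "det B = 1"
  shows "psl A \<otimes>\<^bsub>PSL2R\<^esub> psl B = psl (A ** B)"
  using normal.rcos_sum[OF normal_center_SL2R, of A B] assms
  by (simp add: PSL2R_def FactGroup_def psl_def)

lemma psl_eq_iff: "psl A = psl B \<longleftrightarrow> A = B \<or> A = - B"
  by (auto simp: psl_eq doubleton_eq_iff)

text \<open>
  The element of $PSL(2,R)$ given by a matrix of positive determinant, rescaled to determinant 1.
\<close>

definition pgl :: "real ^ 2 ^ 2 \<Rightarrow> (real ^ 2 ^ 2) set" where
  "pgl M = psl ((1 / sqrt (det M)) *\<^sub>R M)"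

lemma det_scaleR_2: "det (c *\<^sub>R M) = c\<^sup>2 * det M" for M :: "real ^ 2 ^ 2"
  by (simp add: det_2 power2_eq_square algebra_simps)

lemma det_normalized:
  fixes M :: "real ^ 2 ^ 2"
  assumes "det M > 0"
  shows "det ((1 / sqrt (det M)) *\<^sub>R M) = 1"
  using assms by (simp add: det_scaleR_2 power_divide)

lemma scaleR_mult_scaleR: "(c *\<^sub>R A) ** (d *\<^sub>R B) = (c * d) *\<^sub>R (A ** B)"
  for A B :: "real ^ 2 ^ 2"
  by (simp add: matrix_matrix_mult_def vec_eq_iff forall_2 sum_2 algebra_simps)

lemma pgl_mult:
  assumes "det M > 0" "det N > 0"
  shows "pgl M \<otimes>\<^bsub>PSL2R\<^esub> pgl N = pgl (M ** N)"
  using assms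
  by (simp add: pgl_def psl_mult det_normalized det_mul real_sqrt_mult
      scaleR_mult_scaleR)

lemma pgl_scaleR:
  assumes "c \<noteq> 0"
  shows "pgl (c *\<^sub>R M) = pgl M"
proof -
  have "sqrt (det (c *\<^sub>R M)) = \<bar>c\<bar> * sqrt (det M)"
    by (simp add: det_scaleR_2 real_sqrt_mult)
  moreover have "c / \<bar>c\<bar> = 1 \<or> c / \<bar>c\<bar> = -1"
    using assms by (cases "c > 0") auto
  ultimately show ?thesis
    using assms by (cases "c > 0") (auto simp: pgl_def psl_eq_iff)
qed

lemma pgl_det_1: "det M = 1 \<Longrightarrow> pgl M = psl M"
  by (simp add: pgl_def)

text \<open>
  The matrices of positive determinant that represent elements of $\Gamma$. Membership of a word
  in $\Gamma$ can be shown here by multiplying matrices and dropping scalar factors.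
\<close>

definition pgl_lift :: "(real ^ 2 ^ 2) set set \<Rightarrow> (real ^ 2 ^ 2) set" where
  "pgl_lift \<Gamma> = {M. det M > 0 \<and> pgl M \<in> \<Gamma>}"

lemma pgl_lift_mult:
  assumes "subgroup \<Gamma> PSL2R" "M \<in> pgl_lift \<Gamma>" "N \<in> pgl_lift \<Gamma>"
  shows "M ** N \<in> pgl_lift \<Gamma>"
  using assms pgl_mult[of M N] subgroup.m_closed[OF assms(1), of "pgl M" "pgl N"]
  by (simp add: pgl_lift_def det_mul)

lemma pgl_lift_scaleR_iff:
  assumes "c \<noteq> 0"
  shows "c *\<^sub>R M \<in> pgl_lift \<Gamma> \<longleftrightarrow> M \<in> pgl_lift \<Gamma>"
  using assms by (simp add: pgl_lift_def pgl_scaleR det_scaleR_2 zero_less_mult_iff)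


section \<open>Hyperbolic elements fix no cusp\<close>

text \<open>
  The matrices of trace 2 and determinant 1 that fix $x$: the identity plus $s$ times the nilpotent
  $(x,1)^T (1,-x)$, whose kernel and image are the line over $x$.
\<close>

definition unipotent :: "real \<Rightarrow> real \<Rightarrow> real ^ 2 ^ 2" where
  "unipotent x s = mat2 (1 + s * x) (- (s * x\<^sup>2)) s (1 - s * x)"

lemma det_unipotent: "det (unipotent x s) = 1"
  by (simp add: unipotent_def det_mat2 power2_eq_square algebra_simps)

lemma unipotent_0: "unipotent x 0 = mat 1"
  by (simp add: unipotent_def vec_eq_iff forall_2 mat_def)

lemma continuous_unipotent: "continuous_on UNIV (unipotent x)"
proof -
  have "continuous_on UNIV (\<lambda>s. unipotent x s $ i $ j)" for i j :: 2
    using exhaust_2[of i] exhaust_2[of j] unfolding unipotent_def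
    by (elim disjE; simp; intro continuous_intros)
  then have "continuous_on UNIV (\<lambda>s. \<chi> i j. unipotent x s $ i $ j)"
    by (intro continuous_on_vec_lambda)
  then show ?thesis
    by simp
qed

text \<open>
  One of the two representing matrices has trace 2. Any eigenvalue $\mu$ of it
  satisfies $\mu + 1/\mu = 2$, so $\mu = 1$ and the line over $x$ is fixed pointwise.
\<close>

lemma parabolic_fixing_is_unipotent:
  assumes "parabolic g" and "psl_act g (Some x) = Some x"
  obtains s where "s \<noteq> 0" "g = psl (unipotent x s)"
proof -
  from assms(1) obtain V where V: "g = psl V" "det V = 1"
    by (auto simp: parabolic_def carrier_PSL2R)
  with assms(1) have tr: "\<bar>trace V\<bar> = 2" and "psl V \<noteq> psl (mat 1)"
    by (auto simp: parabolic_def one_PSL2R psl_eq)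
  define U where "U = (if trace V = 2 then V else - V)"
  have U: "g = psl U" "det U = 1" "trace U = 2"
    using V tr by (auto simp: U_def psl_eq det_uminus_2 trace_def sum_negf abs_if split: if_splits)
  have ne: "psl U \<noteq> psl (mat 1)"
    using \<open>psl V \<noteq> psl (mat 1)\<close> V U by simp
  define a b c d where "a = U$1$1" and "b = U$1$2" and "c = U$2$1" and "d = U$2$2"
  have Ueq: "U = mat2 a b c d"
    by (simp add: a_def b_def c_def d_def mat2_eta)
  have det1: "a * d - b * c = 1"
    using U(2) by (simp add: Ueq det_mat2)
  have tr2: "d = 2 - a"
    using U(3) by (simp add: Ueq trace_def sum_2)
  have "moebius U (Some x) = Some x"
    using assms(2) U(1) by (simp add: psl_act_psl)
  then have fx: "c * x + d \<noteq> 0" "a * x + b = x * (c * x + d)"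
    by (auto simp: Ueq moebius_def field_simps split: if_splits)
  have b: "b = x * (c * x + d) - a * x"
    using fx(2) by simp
  \<comment> \<open>The number \<open>c * x + d\<close> is the eigenvalue on the line over \<open>x\<close>.\<close>
  have "(c * x + d - 1)\<^sup>2 = 0"
    using det1 unfolding b tr2 by (simp add: power2_eq_square algebra_simps)
  then have a: "a = 1 + c * x"
    using tr2 by simp
  have "U = unipotent x c"
  proof -
    have "d = 1 - c * x" "b = - (c * x\<^sup>2)"
      unfolding b tr2 a by (simp_all add: power2_eq_square algebra_simps)
    then show ?thesis
      by (simp add: Ueq unipotent_def a)
  qed
  moreover from this ne have "c \<noteq> 0"
    by (auto simp: unipotent_0)
  ultimately show ?thesis
    using that U(1) by blast
qed

text \<open>
  If $(x,1)^T$ is an eigenvector for $l$, then $(1,-x)$ is a left eigenvector for $1/l$, so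
  conjugation multiplies the nilpotent $(x,1)^T (1,-x)$ by $l^2$.
\<close>

lemma conj_unipotent:
  assumes "det (mat2 a b c d) = 1" "a * x + b = l * x" "c * x + d = l"
  shows "mat2 a b c d ** unipotent x s = unipotent x (l\<^sup>2 * s) ** mat2 a b c d"
proof -
  have b: "b = l * x - a * x" and d: "d = l - c * x"
    using assms by auto
  \<comment> \<open>The second eigenvalue, belonging to the left eigenvector \<open>(1, -x)\<close>.\<close>
  define u where "u = a - x * c"
  have "u * l = 1"
    using assms(1) unfolding det_mat2 b d u_def by (simp add: algebra_simps)
  then have "u \<noteq> 0" and l: "l = 1 / u"
    by (auto simp: eq_divide_eq mult.commute)
  have a: "a = u + x * c"
    by (simp add: u_def)
  show ?thesis
    unfolding unipotent_def mat2_mult b d l a using \<open>u \<noteq> 0\<close>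
    by (simp add: vec_eq_iff forall_2 power2_eq_square field_simps)
qed

text \<open>
  Discreteness at the identity element, pulled back from the quotient topology to matrices, where
  convergence can be computed entrywise.
\<close>

lemma discrete_isolated_one:
  assumes "fuchsian \<Gamma>"
  obtains W where "open W" "mat 1 \<in> W" "\<And>A. A \<in> W \<Longrightarrow> det A = 1 \<Longrightarrow> psl A \<in> \<Gamma> \<Longrightarrow> psl A = psl (mat 1)"
proof -
  have sub: "subgroup \<Gamma> PSL2R" and dt: "subtopology PSL2R_topology \<Gamma> = discrete_topology \<Gamma>"
    using assms by (auto simp: fuchsian_def)
  have one: "psl (mat 1) \<in> \<Gamma>"
    using subgroup.one_closed[OF sub] by (simp add: one_PSL2R)
  then have "openin (subtopology PSL2R_topology \<Gamma>) {psl (mat 1)}"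
    by (simp add: dt)
  then obtain T where T: "openin PSL2R_topology T" "{psl (mat 1)} = T \<inter> \<Gamma>"
    by (auto simp: openin_subtopology)
  then obtain W where W: "open W" "{A \<in> carrier SL2R. psl A \<in> T} = carrier SL2R \<inter> W"
    unfolding openin_PSL2R_topology openin_open by blast
  show ?thesis
  proof (rule that[OF W(1)])
    show "mat 1 \<in> W"
      using T(2) W(2) by auto
    show "psl A = psl (mat 1)" if "A \<in> W" "det A = 1" "psl A \<in> \<Gamma>" for A
      using that T(2) W(2) by auto
  qed
qed

text \<open>
  The hypothesis $l^2 < \det M$ says that the normalized matrix contracts its eigenvector. Powers
  of it conjugate a parabolic element fixing $p/q$ into unipotent elements of $\Gamma$ with parameter
  tending to 0. These converge to the identity without reaching it, which discreteness forbids.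
\<close>

lemma hyperbolic_fixed_point_not_cusp:
  assumes "fuchsian \<Gamma>" and "M \<in> pgl_lift \<Gamma>"
    and eigen: "M *v vector [p, q] = l *\<^sub>R vector [p, q]" and "q \<noteq> 0" and "l\<^sup>2 < det M"
  shows "Some (p / q) \<notin> cusps \<Gamma>"
proof
  assume "Some (p / q) \<in> cusps \<Gamma>"
  define x where "x = p / q"
  obtain t where t: "t \<noteq> 0" "psl (unipotent x t) \<in> \<Gamma>"
    using \<open>Some (p / q) \<in> cusps \<Gamma>\<close> unfolding cusps_def x_def
    by (blast elim: parabolic_fixing_is_unipotent)
  have sub: "subgroup \<Gamma> PSL2R"
    using assms(1) by (simp add: fuchsian_def)
  interpret PSL: group PSL2R
    by (rule group_PSL2R)
  define r where "r = sqrt (det M)"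
  have r: "r > 0" "r\<^sup>2 = det M"
    using assms(2) by (auto simp: r_def pgl_lift_def)
  define H where "H = (1 / r) *\<^sub>R M"
  define \<mu> where "\<mu> = l / r"
  have H: "det H = 1" "psl H \<in> \<Gamma>"
    using assms(2) by (auto simp: H_def r_def pgl_lift_def det_normalized pgl_def)
  have M: "M$1$1 * p + M$1$2 * q = l * p" "M$2$1 * p + M$2$2 * q = l * q"
    using eigen by (simp_all add: vec_eq_iff forall_2 matrix_vector_mult_def sum_2)
  then have fix_x: "H$1$1 * x + H$1$2 = \<mu> * x" "H$2$1 * x + H$2$2 = \<mu>"
    using r(1) \<open>q \<noteq> 0\<close> by (simp_all add: H_def x_def \<mu>_def field_simps)
  have comm: "H ** unipotent x s = unipotent x (\<mu>\<^sup>2 * s) ** H" for s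
    using conj_unipotent[OF _ fix_x, of s] H(1) by (simp add: mat2_eta)
  have mu: "\<mu>\<^sup>2 < 1"
    using assms(5) r(1) unfolding r(2)[symmetric] by (simp add: \<mu>_def power_divide)
  have mu0: "\<mu> \<noteq> 0"
  proof
    assume "\<mu> = 0"
    then have "H$1$2 = - H$1$1 * x" "H$2$2 = - H$2$1 * x"
      using fix_x by auto
    then show False
      using H(1) by (simp add: det_2)
  qed
  have step: "psl (unipotent x (\<mu>\<^sup>2 * s)) \<in> \<Gamma>" if "psl (unipotent x s) \<in> \<Gamma>" for s
  proof -
    have car: "psl H \<in> carrier PSL2R" "psl (unipotent x (\<mu>\<^sup>2 * s)) \<in> carrier PSL2R"
      using H(1) by (auto simp: carrier_PSL2R det_unipotent)
    have in_\<Gamma>: "psl H \<otimes>\<^bsub>PSL2R\<^esub> psl (unipotent x s) \<otimes>\<^bsub>PSL2R\<^esub> inv\<^bsub>PSL2R\<^esub> psl H \<in> \<Gamma>"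
      using sub that H(2) by (intro subgroup.m_closed subgroup.m_inv_closed)
    have "psl H \<otimes>\<^bsub>PSL2R\<^esub> psl (unipotent x s) = psl (unipotent x (\<mu>\<^sup>2 * s)) \<otimes>\<^bsub>PSL2R\<^esub> psl H"
      using H(1) by (simp add: psl_mult det_unipotent comm)
    then show ?thesis
      using in_\<Gamma> car by (simp add: PSL.m_assoc)
  qed
  have in_\<Gamma>: "psl (unipotent x ((\<mu>\<^sup>2) ^ j * t)) \<in> \<Gamma>" for j
    by (induction j) (use t(2) step in \<open>auto simp: mult.assoc\<close>)
  obtain W where W: "open W" "mat 1 \<in> W"
    "\<And>A. A \<in> W \<Longrightarrow> det A = 1 \<Longrightarrow> psl A \<in> \<Gamma> \<Longrightarrow> psl A = psl (mat 1)"
    using discrete_isolated_one[OF assms(1)] by blast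
  have "(\<lambda>j. (\<mu>\<^sup>2) ^ j) \<longlonglongrightarrow> 0"
    using mu by (intro LIMSEQ_realpow_zero) auto
  then have "(\<lambda>j. (\<mu>\<^sup>2) ^ j * t) \<longlonglongrightarrow> 0"
    by (rule tendsto_mult_left_zero)
  moreover have "isCont (unipotent x) 0"
    using continuous_unipotent by (simp add: continuous_on_eq_continuous_at)
  ultimately have "(\<lambda>j. unipotent x ((\<mu>\<^sup>2) ^ j * t)) \<longlonglongrightarrow> unipotent x 0"
    by (rule isCont_tendsto_compose[rotated])
  then have "\<forall>\<^sub>F j in sequentially. unipotent x ((\<mu>\<^sup>2) ^ j * t) \<in> W"
    using W(1,2) by (intro topological_tendstoD) (auto simp: unipotent_0)
  then obtain j where "unipotent x ((\<mu>\<^sup>2) ^ j * t) \<in> W"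
    by (auto simp: eventually_sequentially)
  then have "psl (unipotent x ((\<mu>\<^sup>2) ^ j * t)) = psl (mat 1)"
    using W(3) in_\<Gamma> det_unipotent by blast
  then have "unipotent x ((\<mu>\<^sup>2) ^ j * t) $ 2 $ 1 = 0"
    by (auto simp: psl_eq_iff mat_def)
  then show False
    using mu0 t(1) by (simp add: unipotent_def)
qed


section \<open>Hyperbolic elements with rational fixed points\<close>

text \<open>
  Multiples of the generators $\rho_{1/n}$ and $\rho_n$ with integer entries.
\<close>

definition int_rho_inv :: "real \<Rightarrow> real ^ 2 ^ 2" where
  "int_rho_inv n = mat2 n n (- n - 1) (- n)"

definition int_rho_n :: "real \<Rightarrow> real ^ 2 ^ 2" where
  "int_rho_n n = mat2 0 n (-1) 0"

definition transl :: "real \<Rightarrow> real ^ 2 ^ 2" where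
  "transl s = mat2 1 s 0 1"

lemmas rho_defs = rho_one_def int_rho_inv_def int_rho_n_def transl_def

lemma det_int_rho: "det rho_one = 1" "det (int_rho_inv n) = n" "det (int_rho_n n) = n" "det (transl s) = 1"
  by (simp_all add: rho_defs det_mat2 algebra_simps)

lemma generator_in_lift:
  assumes "n > 0" and M: "M \<in> {rho_one, int_rho_inv (real n), int_rho_n (real n)}"
  shows "M \<in> pgl_lift (weierstrass_group n)"
proof -
  have "sqrt (real n) *\<^sub>R mat2 1 1 ((- real n - 1) / n) (-1) = (1 / sqrt n) *\<^sub>R int_rho_inv n"
    using assms(1) by (simp add: rho_defs vec_eq_iff forall_2 field_simps)
  then have "pgl (int_rho_inv n) = psl (rho_inv_n n)"
    by (simp add: pgl_def det_int_rho rho_inv_n_def)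
  moreover have "pgl (int_rho_n n) = psl (rho_n n)" "pgl rho_one = psl rho_one"
    by (simp_all add: pgl_def det_int_rho rho_n_def int_rho_n_def det_mat2)
  ultimately show ?thesis
    using assms det_int_rho
    by (auto simp: pgl_lift_def weierstrass_group_def intro!: generate.incl)
qed

text \<open>
  The three involutions multiply to a parabolic element: the sides of the ideal triangle with
  vertices $\infty$, $-1$, $0$ are each folded by one of them, and going once around the resulting
  cusp translates by $n + 2$. The product in reverse order is the inverse translation.
\<close>

lemma transl_in_lift:
  assumes "n > 0" and sub: "subgroup (weierstrass_group n) PSL2R"
  shows "transl (of_int k * (real n + 2)) \<in> pgl_lift (weierstrass_group n)"
proof -
  let ?L = "pgl_lift (weierstrass_group n)"
  note gen = generator_in_lift[OF assms(1)]
  have "int_rho_n n ** (int_rho_inv n ** rho_one) = (- real n) *\<^sub>R transl (real n + 2)"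
    by (simp add: rho_defs mat2_mult vec_eq_iff forall_2 algebra_simps)
  then have up: "transl (real n + 2) \<in> ?L"
    using pgl_lift_mult[OF sub gen pgl_lift_mult[OF sub gen gen], of "int_rho_n n" "int_rho_inv n" rho_one]
      assms(1) pgl_lift_scaleR_iff[of "- real n" "transl (real n + 2)"] by simp
  have "rho_one ** (int_rho_inv n ** int_rho_n n) = real n *\<^sub>R transl (- (real n + 2))"
    by (simp add: rho_defs mat2_mult vec_eq_iff forall_2 algebra_simps)
  then have down: "transl (- (real n + 2)) \<in> ?L"
    using pgl_lift_mult[OF sub gen pgl_lift_mult[OF sub gen gen], of rho_one "int_rho_inv n" "int_rho_n n"]
      assms(1) pgl_lift_scaleR_iff[of "real n" "transl (- (real n + 2))"] by simp
  have add: "transl (s + s') = transl s ** transl s'" for s s'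
    by (simp add: transl_def mat2_mult add.commute)
  show ?thesis
  proof (induction k rule: int_induct[where k = 0])
    case base
    have "transl 0 = mat 1"
      by (simp add: transl_def vec_eq_iff forall_2 mat_def)
    then show ?case
      using subgroup.one_closed[OF sub] by (simp add: pgl_lift_def pgl_det_1 one_PSL2R)
  next
    case (step1 k)
    have "of_int (k + 1) * (real n + 2) = of_int k * (real n + 2) + (real n + 2)"
      by (simp add: algebra_simps)
    then show ?case
      using pgl_lift_mult[OF sub step1(2) up] by (simp only: add)
  next
    case (step2 k)
    have "of_int (k - 1) * (real n + 2) = of_int k * (real n + 2) + - (real n + 2)"
      by (simp add: algebra_simps)
    then show ?case
      using pgl_lift_mult[OF sub step2(2) down] by (simp only: add)
  qed
qed

lemma vector_2_eq_iff: "vector [a, b] = (vector [c, d] :: real ^ 2) \<longleftrightarrow> a = c \<and> b = d"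
  by (auto simp: vec_eq_iff forall_2)

lemma rho_act:
  "rho_one *v vector [x, y] = vector [x + 2 * y, - x - y]"
  "int_rho_inv n *v vector [x, y] = vector [n * (x + y), - (n * (x + y)) - x]"
  "int_rho_n n *v vector [x, y] = vector [n * y, - x]"
  "transl s *v vector [x, y] = vector [x + s * y, y]"
  by (simp_all add: rho_defs mat2_mult_vec vector_2_eq_iff algebra_simps)

theorem theorem2:
  fixes n :: nat
  assumes "n \<ge> 6"
    and "n mod 8 = 0 \<or> n mod 8 = 2 \<or> n mod 8 = 6"
  shows "\<not> pseudomodular (weierstrass_group n)"
proof
  assume "pseudomodular (weierstrass_group n)"
  then have fuchs: "fuchsian (weierstrass_group n)"
    and cusps: "cusps (weierstrass_group n) = insert None (Some ` \<rat>)"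
    by (simp_all add: pseudomodular_def)
  then have sub: "subgroup (weierstrass_group n) PSL2R"
    by (simp add: fuchsian_def)
  have n0: "n > 0"
    using assms(1) by simp
  let ?L = "pgl_lift (weierstrass_group n)"
  let ?a = rho_one and ?b = "int_rho_inv n" and ?c = "int_rho_n n"
  let ?T = "\<lambda>k::int. transl (of_int k * (real n + 2))"
  have no_eigen: False
    if "M \<in> ?L" "M *v vector [of_int p, of_int q] = l *\<^sub>R vector [of_int p, of_int q]" "q \<noteq> 0" "l\<^sup>2 < det M"
    for M and p q :: int and l
  proof -
    have "Some (real_of_int p / of_int q) \<notin> cusps (weierstrass_group n)"
      using hyperbolic_fixed_point_not_cusp[OF fuchs that(1,2) _ that(4)] that(3) by simp
    then show False
      by (simp add: cusps)
  qed
  have "?a \<in> ?L" "?b \<in> ?L" "?c \<in> ?L"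
    using generator_in_lift[OF n0] by auto
  note L = this transl_in_lift[OF n0 sub] pgl_lift_mult[OF sub]
  have scale: "c *\<^sub>R vector [x, y] = (vector [c * x, c * y] :: real ^ 2)" for c x y
    by (simp add: vec_eq_iff forall_2)
  note act = matrix_vector_mul_assoc[symmetric] rho_act
  have n6: "real n \<ge> 6"
    using assms(1) by simp
  then have n2: "36 \<le> (real n)\<^sup>2" "6 * real n \<le> (real n)\<^sup>2"
    using mult_mono[of 6 "real n" 6 "real n"] by (simp_all add: power2_eq_square)
  consider k where "n = 8 * k + 8" | k where "n = 4 * k + 6"
  proof -
    have "\<exists>k. n = 8 * k + 8 \<or> n = 4 * k + 6"
      using assms by presburger
    then show ?thesis
      using that by blast
  qed
  then show False
  proof cases
    \<comment> \<open>\<open>-n/2\<close> is fixed by \<open>caba T\<^sup>k caba\<close>; the exponent is the one for which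
      \<open>T\<^sup>k\<close> carries the image of \<open>-n/2\<close> under \<open>caba\<close> to its preimage.\<close>
    case 1
    let ?g = "?c ** (?a ** (?b ** ?a))"
    let ?M = "?g ** (?T k ** ?g)"
    have mem: "?M \<in> ?L"
      by (intro L)
    have "8 * (of_int (int k) * (real n + 2)) = real n * real n - 6 * real n - 16"
      by (simp add: 1 algebra_simps)
    then have T: "?T k *v vector [real n * (4 - real n), 8] = vector [- 2 * real n - 16, 8]"
      by (simp add: rho_act vector_2_eq_iff algebra_simps)
    have "?g *v vector [- real n, 2] = vector [real n * (4 - real n), 8]"
      by (simp add: act vector_2_eq_iff algebra_simps)
    moreover have "?g *v vector [- 2 * real n - 16, 8] = vector [- 2 * real n * real n, 4 * real n]"
      by (simp add: act vector_2_eq_iff algebra_simps)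
    ultimately have eigen: "?M *v vector [of_int (- int n), of_int 2]
        = (2 * real n) *\<^sub>R vector [of_int (- int n), of_int 2]"
      using T by (simp add: scale flip: matrix_vector_mul_assoc)
    have less: "(2 * real n)\<^sup>2 < det ?M"
    proof -
      have "(2 * real n)\<^sup>2 < ((real n)\<^sup>2)\<^sup>2"
        using n2 n6 by (intro power_strict_mono) auto
      also have "\<dots> = det ?M"
        by (simp add: det_mul det_int_rho power2_eq_square)
      finally show ?thesis .
    qed
    show False
      by (rule no_eigen[OF mem eigen _ less]) simp
  next
    \<comment> \<open>The point \<open>-2n/(n+2)\<close> is fixed by the product of \<open>a\<close> with the conjugate of the involution
      \<open>ababa\<close> by \<open>T\<^sup>k c\<close>.\<close>
    case 2
    let ?k = "int k"
    let ?g = "?c ** ?a" and ?h = "?a ** (?b ** (?a ** (?b ** ?a)))"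
    let ?M = "?c ** (?T (- ?k) ** (?h ** (?T ?k ** ?g)))"
    have mem: "?M \<in> ?L"
      by (intro L)
    have k: "4 * (of_int ?k * (real n + 2)) = real n * real n - 4 * real n - 12"
      by (simp add: 2 algebra_simps)
    have g: "?g *v vector [- 2 * real n, real n + 2] = vector [real n * (real n - 2), - 4]"
      by (simp add: act vector_2_eq_iff algebra_simps)
    have T1: "?T ?k *v vector [real n * (real n - 2), - 4] = vector [2 * real n + 12, - 4]"
      using k unfolding rho_act vector_2_eq_iff by (simp add: algebra_simps)
    have h: "?h *v vector [2 * real n + 12, - 4]
        = vector [- (2 * (real n - 4) * (real n + 2)), - 8]"
      by (simp add: act vector_2_eq_iff algebra_simps)
    have T2: "?T (- ?k) *v vector [- (2 * (real n - 4) * (real n + 2)), - 8]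
        = vector [- 4 * real n - 8, - 8]"
      using k unfolding rho_act vector_2_eq_iff by (simp add: algebra_simps)
    have "?c *v vector [- 4 * real n - 8, - 8] = 4 *\<^sub>R vector [- 2 * real n, real n + 2]"
      by (simp add: rho_act scale vector_2_eq_iff)
    then have eigen: "?M *v vector [of_int (- 2 * int n), of_int (int n + 2)]
      = 4 *\<^sub>R vector [of_int (- 2 * int n), of_int (int n + 2)]"
      using g T1 h T2 by (simp flip: matrix_vector_mul_assoc)
    have less: "4\<^sup>2 < det ?M"
    proof -
      have "4\<^sup>2 < ((real n)\<^sup>2)\<^sup>2"
        using n2(1) by (intro power_strict_mono) auto
      also have "\<dots> = det ?M"
        by (simp add: det_mul det_int_rho power2_eq_square)
      finally show ?thesis .
    qed
    show False
      by (rule no_eigen[OF mem eigen _ less]) simp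
  qed
qed

end
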